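(* Consider the semidefinite program $$SOS^*:=\min_{X\in S_n}\ C\cdot X\quad\text{s.t. } A_i\cdot X=b_i,\ i=1,\ldots,m,\quad X\succeq0,$$ assumed to have an optimal solution, and the sequence of linear programs $$DSOS_k:=\min_X\ C\cdot X\quad\text{s.t. } A_i\cdot X=b_i,\ i=1,\ldots,m,\quad X\in DD(U_k),\qquad k=0,1,2,\ldots,$$ where $U_0=I$ and $U_{k+1}=\mathrm{chol}(X_k)$ with $X_k$ an optimal solution of the $k$-th linear program (an optimal solution being assumed to exist at each iteration). Let $X_k$ (resp. $X_{k+1}$) be an optimal solution of iterate $k$ (resp. $k+1$), and assume that $X_k$ is positive definite and $SOS^*<DSOS_k$. Then $$DSOS_{k+1}<DSOS_k .$$
   Context: $S_n$ is the space of real symmetric $n\times n$ matrices, $A\cdot B=\mathrm{Trace}(AB)$, $C,A_1,\ldots,A_m\in S_n$, and $b\in\mathbb{R}^m$. A symmetric matrix $Q$ is diagonally dominant (dd) if $Q_{ii}\ge\sum_{j\ne i}|Q_{ij}|$ for all $i$. For an $n\times n$ matrix $U$, $DD(U):=\{M\in S_n : M=U^TQU\text{ for some dd matrix }Q\}$. For a positive semidefinite matrix $A$, $\mathrm{chol}(A)$ denotes an upper triangular Cholesky factor $U$ with $A=U^TU$ (unique with positive diagonal entries when $A$ is positive definite). *)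

theory Defs
  imports "HOL-Analysis.Analysis"
begin

(* An n-by-n real matrix has type 'n sqmat (that is, real^'n^'n) with CARD('n) = n. A linear order on the
   index type is needed only to speak of upper triangular matrices. *)

type_synonym 'n sqmat = "((real, 'n) vec, 'n) vec"

definition sym_mats :: "('n::finite sqmat) set" where
  "sym_mats = {M. transpose M = M}"

definition mat_inner :: "'n::finite sqmat \<Rightarrow> 'n sqmat \<Rightarrow> real" where
  "mat_inner A B = trace (A ** B)"

definition psd :: "'n::finite sqmat \<Rightarrow> bool" where
  "psd A \<longleftrightarrow> A \<in> sym_mats \<and> (\<forall>x. 0 \<le> x \<bullet> (A *v x))"

definition pos_def :: "'n::finite sqmat \<Rightarrow> bool" where
  "pos_def A \<longleftrightarrow> A \<in> sym_mats \<and> (\<forall>x. x \<noteq> 0 \<longrightarrow> 0 < x \<bullet> (A *v x))"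

definition diag_dominant :: "'n::finite sqmat \<Rightarrow> bool" where
  "diag_dominant Q \<longleftrightarrow> Q \<in> sym_mats \<and> (\<forall>i. (\<Sum>j\<in>UNIV - {i}. \<bar>Q $ i $ j\<bar>) \<le> Q $ i $ i)"

definition DD :: "'n::finite sqmat \<Rightarrow> ('n sqmat) set" where
  "DD U = {M \<in> sym_mats. \<exists>Q. diag_dominant Q \<and> M = transpose U ** Q ** U}"

definition upper_tri :: "'n::{finite,linorder} sqmat \<Rightarrow> bool" where
  "upper_tri U \<longleftrightarrow> (\<forall>i j. j < i \<longrightarrow> U $ i $ j = 0)"

(* A relation rather than a function, since a singular positive semidefinite matrix can have
   several factors. Positivity of the diagonal makes the factor unique in the definite case. *)
definition is_chol :: "'n::{finite,linorder} sqmat \<Rightarrow> 'n sqmat \<Rightarrow> bool" where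
  "is_chol A U \<longleftrightarrow> psd A \<and> upper_tri U \<and> A = transpose U ** U \<and>
     (pos_def A \<longrightarrow> (\<forall>i. 0 < U $ i $ i))"

(* Only A 1, ..., A m and b 1, ..., b m are used. *)
definition affine_feasible ::
    "nat \<Rightarrow> (nat \<Rightarrow> 'n::finite sqmat) \<Rightarrow> (nat \<Rightarrow> real) \<Rightarrow> ('n sqmat) set" where
  "affine_feasible m A b = {X \<in> sym_mats. \<forall>i\<in>{1..m}. mat_inner (A i) X = b i}"

definition sdp_feasible ::
    "nat \<Rightarrow> (nat \<Rightarrow> 'n::finite sqmat) \<Rightarrow> (nat \<Rightarrow> real) \<Rightarrow> ('n sqmat) set" where
  "sdp_feasible m A b = {X \<in> affine_feasible m A b. psd X}"

definition dd_feasible ::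
    "nat \<Rightarrow> (nat \<Rightarrow> 'n::finite sqmat) \<Rightarrow> (nat \<Rightarrow> real) \<Rightarrow> 'n sqmat \<Rightarrow> ('n sqmat) set" where
  "dd_feasible m A b U = affine_feasible m A b \<inter> DD U"

definition optimal :: "'n::finite sqmat \<Rightarrow> ('n sqmat) set \<Rightarrow> 'n sqmat \<Rightarrow> bool" where
  "optimal C F X \<longleftrightarrow> is_arg_min (mat_inner C) (\<lambda>Y. Y \<in> F) X"

(* Optimal value. If an optimal solution exists, the infimum is the minimum; otherwise
   Inf on the reals carries no useful meaning. *)
definition opt_value :: "'n::finite sqmat \<Rightarrow> ('n sqmat) set \<Rightarrow> real" where
  "opt_value C F = (INF X\<in>F. mat_inner C X)"

definition SOS_val ::
    "'n::finite sqmat \<Rightarrow> nat \<Rightarrow> (nat \<Rightarrow> 'n sqmat) \<Rightarrow> (nat \<Rightarrow> real) \<Rightarrow> real" where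
  "SOS_val C m A b = opt_value C (sdp_feasible m A b)"

definition DSOS_val ::
    "'n::finite sqmat \<Rightarrow> nat \<Rightarrow> (nat \<Rightarrow> 'n sqmat) \<Rightarrow> (nat \<Rightarrow> real) \<Rightarrow> 'n sqmat \<Rightarrow> real" where
  "DSOS_val C m A b U = opt_value C (dd_feasible m A b U)"

definition dsos_iteration ::
    "'n::{finite,linorder} sqmat \<Rightarrow> nat \<Rightarrow> (nat \<Rightarrow> 'n sqmat) \<Rightarrow> (nat \<Rightarrow> real)
      \<Rightarrow> (nat \<Rightarrow> 'n sqmat) \<Rightarrow> (nat \<Rightarrow> 'n sqmat) \<Rightarrow> bool" where
  "dsos_iteration C m A b U X \<longleftrightarrow>
     U 0 = mat 1 \<and>
     (\<forall>k. optimal C (dd_feasible m A b (U k)) (X k)) \<and>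
     (\<forall>k. is_chol (X k) (U (Suc k)))"

end

theory Submission
  imports Defs
begin

text \<open>
  Why the optimal value drops: the change of basis by the Cholesky factor \<open>V\<close> of \<open>X\<^sub>k\<close>
  places \<open>X\<^sub>k = V\<^sup>T I V\<close> in the interior of the new cone \<open>DD V\<close>, because the identity is strictly
  diagonally dominant and \<open>V\<close> is invertible when \<open>X\<^sub>k\<close> is positive definite. Hence a short step
  from \<open>X\<^sub>k\<close> in any symmetric direction stays in the cone (\<open>step_from_factored_matrix_in_DD\<close>).
  The step is taken towards an optimal solution \<open>Y\<close> of the semidefinite program. It stays in the
  affine constraint set, which contains both \<open>X\<^sub>k\<close> and \<open>Y\<close>, so it ends at a feasible point of the
  next linear program; and the linear objective strictly decreases along it, since its value at \<open>Y\<close>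
  is below its value at \<open>X\<^sub>k\<close>.
\<close>

lemma opt_value_eq:
  assumes "optimal C F X"
  shows "opt_value C F = mat_inner C X"
proof -
  have "X \<in> F" and "\<And>Y. Y \<in> F \<Longrightarrow> mat_inner C X \<le> mat_inner C Y"
    using assms by (auto simp: optimal_def is_arg_min_def not_less)
  then show ?thesis
    unfolding opt_value_def by (intro cInf_eq_minimum) auto
qed

lemma mat_inner_affine:
  "mat_inner B (X + t *\<^sub>R (Y - X)) = mat_inner B X + t * (mat_inner B Y - mat_inner B X)"
  by (simp add: mat_inner_def trace_def matrix_matrix_mult_def algebra_simps
      sum.distrib sum_subtractf sum_distrib_left)

lemma sym_mats_affine:
  assumes "X \<in> sym_mats" "Y \<in> sym_mats"
  shows "X + t *\<^sub>R (Y - X) \<in> sym_mats"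
  using assms by (simp add: sym_mats_def transpose_def vec_eq_iff)

lemma affine_feasible_affine:
  assumes "X \<in> affine_feasible m A b" "Y \<in> affine_feasible m A b"
  shows "X + t *\<^sub>R (Y - X) \<in> affine_feasible m A b"
  using assms by (simp add: affine_feasible_def sym_mats_affine mat_inner_affine)

lemma sym_mats_congruence:
  assumes "M \<in> sym_mats"
  shows "transpose W ** M ** W \<in> sym_mats"
  using assms by (simp add: sym_mats_def matrix_transpose_mul matrix_mul_assoc)

lemma matrix_mul_affine:
  fixes X Y L R :: "'n::finite sqmat"
  shows "L ** (X + t *\<^sub>R Y) ** R = L ** X ** R + t *\<^sub>R (L ** Y ** R)"
  by (simp add: vec_eq_iff matrix_matrix_mult_def algebra_simps sum.distrib sum_distrib_left)

text \<open>
  The identity is an interior point of the diagonally dominant matrices. The row condition holds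
  as soon as \<open>t\<close> times the absolute row sum of \<open>D\<close> is at most 1, and the total absolute sum of
  \<open>D\<close> bounds every row sum at once.
\<close>

lemma diag_dominant_near_identity:
  fixes D :: "'n::finite sqmat"
  assumes "D \<in> sym_mats"
  shows "\<exists>t>0. diag_dominant (mat 1 + t *\<^sub>R D)"
proof -
  define S where "S = (\<Sum>i\<in>UNIV. \<Sum>j\<in>UNIV. \<bar>D $ i $ j\<bar>)"
  define t where "t = 1 / (1 + S)"
  have "0 \<le> S"
    unfolding S_def by (intro sum_nonneg) simp
  then have "0 < t" and "t * S \<le> 1"
    by (auto simp: t_def field_simps)
  have "mat 1 + t *\<^sub>R D \<in> sym_mats"
    using assms by (simp add: sym_mats_def transpose_def vec_eq_iff mat_def)
  moreover have "(\<Sum>j\<in>UNIV - {i}. \<bar>(mat 1 + t *\<^sub>R D) $ i $ j\<bar>) \<le> (mat 1 + t *\<^sub>R D) $ i $ i" for i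
  proof -
    have "(\<Sum>j\<in>UNIV - {i}. \<bar>(mat 1 + t *\<^sub>R D) $ i $ j\<bar>) = t * (\<Sum>j\<in>UNIV - {i}. \<bar>D $ i $ j\<bar>)"
      using \<open>0 < t\<close> by (auto simp: mat_def sum_distrib_left abs_mult intro!: sum.cong)
    moreover have "(\<Sum>j\<in>UNIV. \<bar>D $ i $ j\<bar>) \<le> S"
      unfolding S_def
      by (rule member_le_sum[where f = "\<lambda>i. \<Sum>j\<in>UNIV. \<bar>D $ i $ j\<bar>"]) (auto intro: sum_nonneg)
    then have "t * (\<bar>D $ i $ i\<bar> + (\<Sum>j\<in>UNIV - {i}. \<bar>D $ i $ j\<bar>)) \<le> t * S"
      using \<open>0 < t\<close> by (intro mult_left_mono) (auto simp: sum.remove[of UNIV i])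
    moreover have "- (t * D $ i $ i) \<le> t * \<bar>D $ i $ i\<bar>"
      using \<open>0 < t\<close> by (metis abs_ge_minus_self abs_mult abs_of_pos)
    ultimately show ?thesis
      using \<open>t * S \<le> 1\<close> by (simp add: mat_def distrib_left)
  qed
  ultimately show ?thesis
    using \<open>0 < t\<close> unfolding diag_dominant_def by blast
qed

text \<open>
  A kernel vector of \<open>V\<close> would be an isotropic vector of the form defined by \<open>V\<^sup>T V\<close>.
\<close>

lemma invertible_factor_of_pos_def:
  fixes V :: "'n::finite sqmat"
  assumes "pos_def (transpose V ** V)"
  shows "invertible V"
proof -
  have "x = 0" if "V *v x = 0" for x
  proof (rule ccontr)
    assume "x \<noteq> 0"
    then have "0 < x \<bullet> ((transpose V ** V) *v x)"
      using assms by (simp add: pos_def_def)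
    also have "(transpose V ** V) *v x = 0"
      using that by (simp flip: matrix_vector_mul_assoc)
    finally show False by simp
  qed
  then obtain W where "W ** V = mat 1"
    using matrix_left_invertible_ker[of V] by blast
  then show ?thesis
    using invertible_left_inverse by blast
qed

text \<open>
  Conjugation by the inverse of \<open>V\<close> takes \<open>V\<^sup>T V\<close> to the identity and \<open>DD V\<close> to the diagonally
  dominant matrices, which reduces the claim to a neighbourhood of the identity.
\<close>

lemma step_from_factored_matrix_in_DD:
  fixes V Y :: "'n::finite sqmat"
  assumes "invertible V" and "Y \<in> sym_mats"
  shows "\<exists>t>0. transpose V ** V + t *\<^sub>R (Y - transpose V ** V) \<in> DD V"
proof -
  let ?X = "transpose V ** V"
  obtain W where "W ** V = mat 1"
    using assms(1) by (auto simp: invertible_def)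
  then have "transpose V ** transpose W = mat 1"
    by (metis matrix_transpose_mul transpose_mat)
  have X_sym: "?X \<in> sym_mats"
    by (simp add: sym_mats_def matrix_transpose_mul)
  define D where "D = transpose W ** (Y - ?X) ** W"
  have "Y - ?X \<in> sym_mats"
    using assms(2) X_sym by (simp add: sym_mats_def transpose_def vec_eq_iff)
  then obtain t where "0 < t" and dd: "diag_dominant (mat 1 + t *\<^sub>R D)"
    unfolding D_def using diag_dominant_near_identity sym_mats_congruence by blast
  have "transpose V ** D ** V = (transpose V ** transpose W) ** (Y - ?X) ** (W ** V)"
    by (simp add: D_def matrix_mul_assoc)
  also have "\<dots> = Y - ?X"
    using \<open>W ** V = mat 1\<close> \<open>transpose V ** transpose W = mat 1\<close> by simp
  finally have "?X + t *\<^sub>R (Y - ?X) = transpose V ** (mat 1 + t *\<^sub>R D) ** V"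
    by (simp add: matrix_mul_affine)
  moreover have "?X + t *\<^sub>R (Y - ?X) \<in> sym_mats"
    using X_sym assms(2) by (rule sym_mats_affine)
  ultimately show ?thesis
    using \<open>0 < t\<close> dd unfolding DD_def by blast
qed

theorem theorem3p3p1:
  fixes C :: "'n::{finite,linorder} sqmat"
    and A :: "nat \<Rightarrow> 'n sqmat"
    and b :: "nat \<Rightarrow> real"
    and m :: nat
    and U X :: "nat \<Rightarrow> 'n sqmat"
    and k :: nat
  assumes "C \<in> sym_mats"
    and "\<forall>i\<in>{1..m}. A i \<in> sym_mats"
    and "\<exists>Y. optimal C (sdp_feasible m A b) Y"
    and "dsos_iteration C m A b U X"
    and "pos_def (X k)"
    and "SOS_val C m A b < DSOS_val C m A b (U k)"
  shows "DSOS_val C m A b (U (Suc k)) < DSOS_val C m A b (U k)"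
proof -
  let ?V = "U (Suc k)"
  obtain Y where Y: "optimal C (sdp_feasible m A b) Y"
    using assms(3) by blast
  then have Y_feas: "Y \<in> affine_feasible m A b"
    by (simp add: optimal_def is_arg_min_def sdp_feasible_def)
  have opt: "optimal C (dd_feasible m A b (U j)) (X j)" for j
    using assms(4) by (simp add: dsos_iteration_def)
  then have X_feas: "X k \<in> affine_feasible m A b"
    by (simp add: optimal_def is_arg_min_def dd_feasible_def)
  have val: "DSOS_val C m A b (U j) = mat_inner C (X j)" for j
    unfolding DSOS_val_def using opt by (rule opt_value_eq)
  have gap: "mat_inner C Y < mat_inner C (X k)"
    using assms(6) opt_value_eq[OF Y] by (simp add: SOS_val_def val)
  have X_eq: "X k = transpose ?V ** ?V"
    using assms(4) by (auto simp: dsos_iteration_def is_chol_def)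
  then have "invertible ?V"
    using assms(5) by (simp add: invertible_factor_of_pos_def)
  moreover have "Y \<in> sym_mats"
    using Y_feas by (simp add: affine_feasible_def)
  ultimately obtain t where "0 < t" and "X k + t *\<^sub>R (Y - X k) \<in> DD ?V"
    using step_from_factored_matrix_in_DD X_eq by metis
  then have "X k + t *\<^sub>R (Y - X k) \<in> dd_feasible m A b ?V"
    using affine_feasible_affine[OF X_feas Y_feas] by (simp add: dd_feasible_def)
  then have "mat_inner C (X (Suc k)) \<le> mat_inner C (X k + t *\<^sub>R (Y - X k))"
    using opt[of "Suc k"] by (auto simp: optimal_def is_arg_min_def not_less)
  also have "\<dots> < mat_inner C (X k)"
    using \<open>0 < t\<close> gap by (simp add: mat_inner_affine mult_pos_neg)
  finally show ?thesis
    by (simp add: val)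
qed

end
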